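(* Let $k$ be a positive integer and let $I$ be a complete bipartite preference structure of size $k$. A strong polyhedral realization of (the underlying two-sided agent structure of) $I$ exists if and only if $k=4$. In that case (i.e. when $k=4$), the underlying graph of a strong polyhedral realization is isomorphic to the cube graph $Q_3$.
   Context: All graphs are finite and simple. A complete bipartite preference structure of size $k$ is a tuple $I=(M,W,\{\succ_m\}_{m\in M},\{\succ_w\}_{w\in W})$, where $M$ and $W$ are disjoint finite sets with $|M|=|W|=k$, each $\succ_m$ is a strict total order on $W$, and each $\succ_w$ is a strict total order on $M$. A polyhedral graph is the graph (vertices and edges) of a convex three-dimensional polyhedron; equivalently, by Steinitz's theorem, a planar 3-connected graph. A strong polyhedral realization of the underlying two-sided agent structure of $I$ consists of a bipartite polyhedral graph $G=(V_M\sqcup V_W,E)$ with bipartition classes $V_M,V_W$ satisfying $|V_M|=|V_W|=k$, together with bijections $M\to V_M$ and $W\to V_W$, such that each vertex is adjacent to exactly $k-1$ vertices of the opposite bipartition class. (The preference orders play no role in this condition.) The cube graph $Q_3$ has vertex set $\{0,1\}^3$, two vertices being adjacent if and only if they differ in exactly one coordinate. *)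

theory Defs
  imports "HOL-Analysis.Analysis" "HOL-Library.Infinite_Typeclass"
begin

section \<open>Complete bipartite preference structures\<close>

text \<open>\<open>(w, w') \<in> man_pref I m\<close> means that \<open>m\<close> ranks \<open>w\<close> above \<open>w'\<close>, and dually for
  \<open>woman_pref\<close>. Values of these functions outside \<open>men I\<close>, \<open>women I\<close> carry no information.\<close>

record 'a pref_structure =
  men :: "'a set"
  women :: "'a set"
  man_pref :: "'a \<Rightarrow> 'a rel"
  woman_pref :: "'a \<Rightarrow> 'a rel"

text \<open>The library's \<open>strict_linear_order_on\<close> does not confine the relation to the given set.\<close>

definition strict_total_order_on :: "'a set \<Rightarrow> 'a rel \<Rightarrow> bool" where
  "strict_total_order_on A r \<longleftrightarrow> r \<subseteq> A \<times> A \<and> strict_linear_order_on A r"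

definition complete_bipartite_pref_structure :: "nat \<Rightarrow> 'a pref_structure \<Rightarrow> bool" where
  "complete_bipartite_pref_structure k I \<longleftrightarrow>
     finite (men I) \<and> finite (women I) \<and> men I \<inter> women I = {} \<and>
     card (men I) = k \<and> card (women I) = k \<and>
     (\<forall>m\<in>men I. strict_total_order_on (women I) (man_pref I m)) \<and>
     (\<forall>w\<in>women I. strict_total_order_on (men I) (woman_pref I w))"


section \<open>Finite simple graphs\<close>

record 'v ugraph =
  vertices :: "'v set"
  edges :: "'v set set"

definition simple_graph :: "'v ugraph \<Rightarrow> bool" where
  "simple_graph G \<longleftrightarrow>
     finite (vertices G) \<and> (\<forall>e\<in>edges G. e \<subseteq> vertices G \<and> card e = 2)"

definition graph_isomorphic :: "'u ugraph \<Rightarrow> 'v ugraph \<Rightarrow> bool" where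
  "graph_isomorphic G H \<longleftrightarrow>
     (\<exists>h. bij_betw h (vertices G) (vertices H) \<and>
          (\<forall>x\<in>vertices G. \<forall>y\<in>vertices G. {x, y} \<in> edges G \<longleftrightarrow> {h x, h y} \<in> edges H))"

definition bipartition :: "'v ugraph \<Rightarrow> 'v set \<Rightarrow> 'v set \<Rightarrow> bool" where
  "bipartition G A B \<longleftrightarrow>
     A \<union> B = vertices G \<and> A \<inter> B = {} \<and> (\<forall>e\<in>edges G. \<exists>a\<in>A. \<exists>b\<in>B. e = {a, b})"

definition cube_graph :: "(nat ^ 3) ugraph" where
  "cube_graph =
     \<lparr>vertices = {x. \<forall>i. x $ i \<in> {0, 1}},
      edges = {{x, y} | x y. (\<forall>i. x $ i \<in> {0, 1}) \<and> (\<forall>i. y $ i \<in> {0, 1}) \<and>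
                             card {i. x $ i \<noteq> y $ i} = 1}\<rparr>"


section \<open>Polyhedral graphs\<close>

text \<open>A convex three-dimensional polyhedron is a bounded one, hence \<open>polytope\<close>: the library's
  \<open>polyhedron\<close> admits unbounded sets. The endpoints of a segment that is a one-dimensional face
  are automatically distinct vertices.\<close>

definition polytope_graph :: "(real ^ 3) set \<Rightarrow> (real ^ 3) ugraph" where
  "polytope_graph P =
     \<lparr>vertices = {v. v extreme_point_of P},
      edges = {{u, v} | u v. closed_segment u v edge_of P}\<rparr>"

definition polyhedral_graph :: "'v ugraph \<Rightarrow> bool" where
  "polyhedral_graph G \<longleftrightarrow>
     simple_graph G \<and>
     (\<exists>P :: (real ^ 3) set. polytope P \<and> aff_dim P = 3 \<and> graph_isomorphic G (polytope_graph P))"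


section \<open>Strong polyhedral realizations\<close>

definition strong_polyhedral_realization ::
  "nat \<Rightarrow> 'a pref_structure \<Rightarrow> 'v ugraph \<Rightarrow> 'v set \<Rightarrow> 'v set \<Rightarrow> ('a \<Rightarrow> 'v) \<Rightarrow> ('a \<Rightarrow> 'v) \<Rightarrow> bool"
where
  "strong_polyhedral_realization k I G VM VW f g \<longleftrightarrow>
     polyhedral_graph G \<and> bipartition G VM VW \<and> card VM = k \<and> card VW = k \<and>
     bij_betw f (men I) VM \<and> bij_betw g (women I) VW \<and>
     (\<forall>v\<in>VM. card {w\<in>VW. {v, w} \<in> edges G} = k - 1) \<and>
     (\<forall>w\<in>VW. card {v\<in>VM. {v, w} \<in> edges G} = k - 1)"

end

theory Submission
  imports Defs
begin

text \<open>In a strong polyhedral realization every vertex misses exactly one vertex of the other class, so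
  the graph is a complete bipartite graph \<open>K\<^sub>k\<^sub>,\<^sub>k\<close> minus a perfect matching.

  Every vertex of a three-dimensional polytope has at least three neighbours, whence \<open>k - 1 \<ge> 3\<close>.
  For \<open>k \<ge> 5\<close>, label the classes \<open>a\<^sub>i\<close>, \<open>b\<^sub>i\<close> with \<open>a\<^sub>i\<close>, \<open>b\<^sub>i\<close> non-adjacent. The boundary of the
  polytope without \<open>a\<^sub>5\<close> is a plane, in which the paths \<open>a\<^sub>1 b\<^sub>i a\<^sub>2\<close> (\<open>i = 3, 4, 5\<close>) form a theta
  curve. The open arcs from \<open>a\<^sub>3\<close> to \<open>b\<^sub>4\<close>, to \<open>b\<^sub>5\<close> and, through \<open>b\<^sub>1\<close> and \<open>a\<^sub>4\<close>, to \<open>b\<^sub>3\<close> form a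
  connected set avoiding it, but no complementary component of a theta curve borders the interiors of
  all three arcs. For \<open>k = 4\<close> the graph is \<open>Q\<^sub>3\<close>, which the unit cube realizes.\<close>

section \<open>Theta curves in the plane\<close>

text \<open>\<open>inside J\<close> is a union of components of the complement of \<open>J\<close>,
  so a connected set avoiding \<open>J\<close> cannot leave it.\<close>

lemma connected_subset_inside:
  assumes "connected C" "C \<inter> J = {}" "C \<inter> inside J \<noteq> {}"
  shows "C \<subseteq> inside J"
proof
  fix y assume y: "y \<in> C"
  obtain x where x: "x \<in> C" "x \<in> inside J" using assms(3) by blast
  have "connected_component (- J) x y"
    unfolding connected_component_def using assms(1,2) x y by blast
  then show "y \<in> inside J" using inside_same_component x(2) by blast
qed

text \<open>If \<open>c3\<close> entered the inside of the Jordan curve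
  \<open>c1 \<union> c2\<close>, it would split that region into \<open>A\<close>, \<open>B\<close>
  and its own open arc. The set \<open>S\<close>, tied to \<open>c3\<close> at \<open>x3\<close>,
  would lie in the region, hence meet \<open>A\<close> or \<open>B\<close>. Connectedness would then
  drag \<open>x2\<close> into \<open>A\<close> or \<open>x1\<close> into \<open>B\<close>, although
  both points lie on the curve \<open>c1 \<union> c2\<close> itself.\<close>

lemma theta_curve_inner_arc:
  fixes c1 c2 c3 :: "real \<Rightarrow> complex"
  assumes c1: "simple_path c1" "pathstart c1 = a" "pathfinish c1 = b"
    and c2: "simple_path c2" "pathstart c2 = a" "pathfinish c2 = b"
    and c3: "simple_path c3" "pathstart c3 = a" "pathfinish c3 = b"
    and ab: "a \<noteq> b"
    and c12: "path_image c1 \<inter> path_image c2 = {a, b}"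
    and c13: "path_image c1 \<inter> path_image c3 = {a, b}"
    and c23: "path_image c2 \<inter> path_image c3 = {a, b}"
    and S: "S \<noteq> {}" "connected S" "S \<inter> (path_image c1 \<union> path_image c2 \<union> path_image c3) = {}"
    and x1: "x1 \<in> path_image c1 - {a, b}" "connected (insert x1 S)"
    and x2: "x2 \<in> path_image c2 - {a, b}" "connected (insert x2 S)"
    and x3: "x3 \<in> path_image c3 - {a, b}" "connected (insert x3 S)"
  shows "path_image c3 \<inter> inside (path_image c1 \<union> path_image c2) = {}"
proof (rule ccontr)
  define A where "A = inside (path_image c1 \<union> path_image c3)"
  define B where "B = inside (path_image c2 \<union> path_image c3)"
  define I where "I = inside (path_image c1 \<union> path_image c2)"
  assume "path_image c3 \<inter> inside (path_image c1 \<union> path_image c2) \<noteq> {}"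
  then have eq: "A \<union> B \<union> (path_image c3 - {a, b}) = I"
    using split_inside_simple_closed_curve[OF c1 c2 c3 ab c12 c13 c23]
    unfolding A_def B_def I_def by metis
  have "insert x3 S \<subseteq> I"
    unfolding I_def
    by (rule connected_subset_inside[OF x3(2)])
      (use x3 S(3) c13 c23 eq in \<open>auto simp: I_def\<close>)
  moreover obtain s where s: "s \<in> S" using S(1) by blast
  ultimately have "s \<in> A \<union> B" using eq S(3) by blast
  then show False
  proof
    assume "s \<in> A"
    then have "insert x2 S \<subseteq> A"
      unfolding A_def
      by (intro connected_subset_inside[OF x2(2)]) (use x2 S(3) c12 c23 s in auto)
    then have "x2 \<in> I" using eq by blast
    then show False using x2 unfolding I_def inside_def by blast
  next
    assume "s \<in> B"
    then have "insert x1 S \<subseteq> B"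
      unfolding B_def
      by (intro connected_subset_inside[OF x1(2)]) (use x1 S(3) c12 c13 s in auto)
    then have "x1 \<in> I" using eq by blast
    then show False using x1 unfolding I_def inside_def by blast
  qed
qed

text \<open>Choose \<open>q\<close> inside \<open>c1 \<union> c2\<close>. As \<open>c3\<close> is not inside \<open>c1 \<union> c2\<close>, inversion at \<open>q\<close> turns it
  into an arc inside the image of \<open>c1 \<union> c2\<close>, which the previous lemma forbids as well.\<close>

lemma theta_curve_no_common_component:
  fixes c1 c2 c3 :: "real \<Rightarrow> complex"
  assumes c1: "simple_path c1" "pathstart c1 = a" "pathfinish c1 = b"
    and c2: "simple_path c2" "pathstart c2 = a" "pathfinish c2 = b"
    and c3: "simple_path c3" "pathstart c3 = a" "pathfinish c3 = b"
    and ab: "a \<noteq> b"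
    and c12: "path_image c1 \<inter> path_image c2 = {a, b}"
    and c13: "path_image c1 \<inter> path_image c3 = {a, b}"
    and c23: "path_image c2 \<inter> path_image c3 = {a, b}"
    and S: "S \<noteq> {}" "connected S" "S \<inter> (path_image c1 \<union> path_image c2 \<union> path_image c3) = {}"
    and x1: "x1 \<in> path_image c1 - {a, b}" "connected (insert x1 S)"
    and x2: "x2 \<in> path_image c2 - {a, b}" "connected (insert x2 S)"
    and x3: "x3 \<in> path_image c3 - {a, b}" "connected (insert x3 S)"
  shows False
proof -
  define J where "J = path_image c1 \<union> path_image c2"
  have disj: "path_image c3 \<inter> inside J = {}"
    unfolding J_def by (rule theta_curve_inner_arc[OF assms])
  have loop: "simple_path (c1 +++ reversepath c2)"
    using c1 c2 ab c12 by (simp add: simple_path_join_loop_eq arc_simple_path simple_path_reversepath)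
  have J: "J = path_image (c1 +++ reversepath c2)"
    using c1 c2 by (simp add: J_def path_image_join)
  have Jin: "inside J \<noteq> {}" "open (inside J)"
    using Jordan_inside_outside[OF loop] c1 c2 unfolding J by auto
  have cJ: "compact J" unfolding J using loop by (rule compact_simple_path_image)
  have x3J: "x3 \<notin> J" using x3 c13 c23 by (auto simp: J_def)
  \<comment> \<open>If \<open>S\<close> met the inside of \<open>J\<close>, it would take
    \<open>x3\<close> along.\<close>
  have Sdisj: "S \<inter> inside J = {}"
  proof (rule ccontr)
    assume "S \<inter> inside J \<noteq> {}"
    then have "insert x3 S \<subseteq> inside J"
      by (intro connected_subset_inside[OF x3(2)]) (use S(3) x3J in \<open>auto simp: J_def\<close>)
    then show False using disj x3 by blast
  qed
  obtain q where q: "q \<in> inside J" using Jin by blast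
  obtain r where r: "r > 0" "ball q r \<subseteq> inside J" using Jin(2) q open_contains_ball by blast
  \<comment> \<open>Inversion at \<open>q\<close>. Since \<open>inverse 0 = 0\<close>,
    \<open>\<phi>\<close> and \<open>\<psi>\<close> are mutually inverse everywhere; only continuity
    fails, at \<open>q\<close> and at \<open>0\<close> respectively.\<close>
  define \<phi> where "\<phi> z = inverse (z - q)" for z :: complex
  define \<psi> where "\<psi> w = q + inverse w" for w :: complex
  have \<psi>\<phi>: "\<psi> (\<phi> z) = z" for z by (simp add: \<phi>_def \<psi>_def)
  have \<phi>\<psi>: "\<phi> (\<psi> z) = z" for z by (simp add: \<phi>_def \<psi>_def)
  have inj: "inj_on \<phi> X" for X using \<psi>\<phi> by (metis inj_onI)
  have cont: "continuous_on X \<phi>" if "q \<notin> X" for X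
    unfolding \<phi>_def using that by (intro continuous_intros) auto
  have qJ: "q \<notin> J" using q by (auto simp: inside_def)
  have q1: "q \<notin> path_image c1" and q2: "q \<notin> path_image c2" using qJ by (auto simp: J_def)
  have q3: "q \<notin> path_image c3" and qS: "q \<notin> S" using q disj Sdisj by auto
  \<comment> \<open>Inversion turns the outside of \<open>J\<close> into the inside of its image.
    Otherwise the unbounded outer region \<open>U\<close> of the image, pulled back, would be a
    connected set off \<open>J\<close> containing both \<open>x3\<close> and points near
    \<open>q\<close>.\<close>
  have x3in: "\<phi> x3 \<in> inside (\<phi> ` J)"
  proof (rule ccontr)
    assume "\<phi> x3 \<notin> inside (\<phi> ` J)"
    moreover have "\<phi> x3 \<notin> \<phi> ` J" using x3J \<psi>\<phi> by (metis imageE)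
    ultimately have xo: "\<phi> x3 \<in> outside (\<phi> ` J)" using inside_Un_outside by blast
    define U where "U = outside (\<phi> ` J)"
    have cphi: "compact (\<phi> ` J)" using cJ cont[OF qJ] by (rule compact_continuous_image[rotated])
    then have U: "open U" "connected U"
      unfolding U_def
      by (simp_all add: open_outside compact_imp_closed connected_outside compact_imp_bounded)
    have unb: "\<not> bounded U" unfolding U_def
      using cphi by (simp add: compact_imp_bounded unbounded_outside)
    \<comment> \<open>The point \<open>0\<close> stands for infinity, where \<open>\<psi>\<close> is
      not continuous; deleting one point keeps an open planar set connected.\<close>
    have "connected (U - {0})" using U by (simp add: connected_open_delete)
    then have con: "connected (\<psi> ` (U - {0}))"
      by (intro connected_continuous_image) (auto simp: \<psi>_def intro!: continuous_intros)
    have dJ: "\<psi> ` (U - {0}) \<inter> J = {}"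
    proof -
      have "w \<in> \<phi> ` J" if "\<psi> w \<in> J" for w using that \<phi>\<psi> by (metis imageI)
      then show ?thesis unfolding U_def outside_def by auto
    qed
    have "\<phi> x3 \<noteq> 0" using x3 q3 by (auto simp: \<phi>_def)
    then have x3U: "x3 \<in> \<psi> ` (U - {0})" using xo \<psi>\<phi> unfolding U_def
      by (metis DiffI image_eqI singletonD)
    \<comment> \<open>Points of \<open>U\<close> at distance more than \<open>1 / r\<close> from the
      origin are pulled back into the ball around \<open>q\<close>.\<close>
    obtain w where w: "w \<in> U" "norm w > 1 / r"
      using unb unfolding bounded_iff by (meson not_le)
    then have w0: "w \<noteq> 0" using r by auto
    have "norm (inverse w) = 1 / norm w" by (simp add: norm_inverse divide_inverse)
    also have "\<dots> < r" using w(2) r(1) w0 by (simp add: divide_less_eq mult.commute)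
    finally have "norm (inverse w) < r" .
    then have "\<psi> w \<in> ball q r" by (simp add: \<psi>_def dist_norm)
    then have "\<psi> ` (U - {0}) \<inter> inside J \<noteq> {}" using w w0 r by blast
    then have "\<psi> ` (U - {0}) \<subseteq> inside J" by (rule connected_subset_inside[OF con dJ])
    then show False using x3U x3 disj by blast
  qed
  have img: "\<phi> ` X \<inter> \<phi> ` Y = \<phi> ` (X \<inter> Y)" for X Y
    using inj by (metis image_Int)
  have conn: "connected (\<phi> ` X)" if "connected X" "q \<notin> X" for X
    using connected_continuous_image[OF cont] that by blast
  have con': "connected (insert (\<phi> y) (\<phi> ` S))" if "connected (insert y S)" "y \<noteq> q" for y
    using conn[of "insert y S"] that qS by auto
  have mem: "\<phi> y \<in> path_image (\<phi> \<circ> c) - {\<phi> a, \<phi> b}" if "y \<in> path_image c - {a, b}" for y c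
    using that \<psi>\<phi> unfolding path_image_compose by (metis Diff_iff empty_iff image_eqI insert_iff)
  have "path_image (\<phi> \<circ> c3) \<inter> inside (path_image (\<phi> \<circ> c1) \<union> path_image (\<phi> \<circ> c2)) = {}"
  proof (rule theta_curve_inner_arc)
    show "simple_path (\<phi> \<circ> c1)" "simple_path (\<phi> \<circ> c2)" "simple_path (\<phi> \<circ> c3)"
      using c1 c2 c3 cont q1 q2 q3 inj by (auto intro!: simple_path_continuous_image)
    show "pathstart (\<phi> \<circ> c1) = \<phi> a" "pathstart (\<phi> \<circ> c2) = \<phi> a" "pathstart (\<phi> \<circ> c3) = \<phi> a"
      "pathfinish (\<phi> \<circ> c1) = \<phi> b" "pathfinish (\<phi> \<circ> c2) = \<phi> b" "pathfinish (\<phi> \<circ> c3) = \<phi> b"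
      using c1 c2 c3 by (auto simp: pathstart_compose pathfinish_compose)
    show "\<phi> a \<noteq> \<phi> b" using ab \<psi>\<phi> by metis
    show "path_image (\<phi> \<circ> c1) \<inter> path_image (\<phi> \<circ> c2) = {\<phi> a, \<phi> b}"
      "path_image (\<phi> \<circ> c1) \<inter> path_image (\<phi> \<circ> c3) = {\<phi> a, \<phi> b}"
      "path_image (\<phi> \<circ> c2) \<inter> path_image (\<phi> \<circ> c3) = {\<phi> a, \<phi> b}"
      unfolding path_image_compose img c12 c13 c23 by auto
    show "\<phi> ` S \<noteq> {}" "connected (\<phi> ` S)" using S qS conn by auto
    show "\<phi> ` S \<inter> (path_image (\<phi> \<circ> c1) \<union> path_image (\<phi> \<circ> c2) \<union> path_image (\<phi> \<circ> c3)) = {}"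
      unfolding path_image_compose image_Un[symmetric] img S(3) by simp
    show "\<phi> x1 \<in> path_image (\<phi> \<circ> c1) - {\<phi> a, \<phi> b}" "\<phi> x2 \<in> path_image (\<phi> \<circ> c2) - {\<phi> a, \<phi> b}"
      "\<phi> x3 \<in> path_image (\<phi> \<circ> c3) - {\<phi> a, \<phi> b}"
      using x1 x2 x3 mem by blast+
    show "connected (insert (\<phi> x1) (\<phi> ` S))" "connected (insert (\<phi> x2) (\<phi> ` S))"
      "connected (insert (\<phi> x3) (\<phi> ` S))"
      using x1 x2 x3 q1 q2 q3 con' by blast+
  qed
  moreover have "\<phi> x3 \<in> path_image (\<phi> \<circ> c3)" using x3 mem by blast
  ultimately show False using x3in
    unfolding path_image_compose J_def image_Un by blast
qed


section \<open>Vertices and edges of polytopes\<close>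

lemma edge_segment_neq: "closed_segment u v edge_of P \<Longrightarrow> u \<noteq> v"
  by (auto simp: edge_of_def)

lemma edge_segment_extreme:
  assumes "closed_segment u v edge_of P"
  shows "u extreme_point_of P" "v extreme_point_of P"
  using assms segment_face_of unfolding edge_of_def by blast+

text \<open>A common point other than \<open>u\<close> and \<open>v\<close> is interior to the first
  edge, so the face property puts \<open>u\<close> and \<open>v\<close> into the second edge. Being
  vertices of \<open>P\<close>, they are its endpoints, and the edges coincide. The argument is
  applied in both directions.\<close>

lemma edge_segment_Int:
  assumes e: "closed_segment u v edge_of P" and f: "closed_segment x y edge_of P"
    and ne: "{u, v} \<noteq> {x, y}"
  shows "closed_segment u v \<inter> closed_segment x y \<subseteq> {u, v} \<inter> {x, y}"
proof -
  have *: "closed_segment u v \<inter> closed_segment x y \<subseteq> {u, v}"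
    if e: "closed_segment u v edge_of P" and f: "closed_segment x y edge_of P"
    and ne: "{u, v} \<noteq> {x, y}" for u v x y
  proof
    fix z assume z: "z \<in> closed_segment u v \<inter> closed_segment x y"
    show "z \<in> {u, v}"
    proof (rule ccontr)
      assume "z \<notin> {u, v}"
      then have "z \<in> open_segment u v" using z by (simp add: open_segment_def)
      moreover have face: "closed_segment x y face_of P" using f edge_of_def by blast
      moreover have "u extreme_point_of P" "v extreme_point_of P"
        using edge_segment_extreme[OF e] by auto
      ultimately have "u \<in> closed_segment x y" "v \<in> closed_segment x y"
        using face_ofD[OF face] z by (auto simp: extreme_point_of_def)
      then have "u extreme_point_of closed_segment x y" "v extreme_point_of closed_segment x y"
        using extreme_point_of_face[OF face] edge_segment_extreme[OF e] by auto
      then have "u \<in> {x, y}" "v \<in> {x, y}" by (auto simp: extreme_point_of_segment)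
      then show False using ne edge_segment_neq[OF e] by auto
    qed
  qed
  show ?thesis using *[OF e f ne] *[OF f e] ne by auto
qed

lemma edge_segment_extreme_mem:
  assumes e: "closed_segment u v edge_of P" and p: "p extreme_point_of P"
    and "p \<in> closed_segment u v"
  shows "p \<in> {u, v}"
proof -
  have "closed_segment u v face_of P" using e edge_of_def by blast
  then have "p extreme_point_of closed_segment u v" using assms extreme_point_of_face by blast
  then show ?thesis by (auto simp: extreme_point_of_segment)
qed

lemma connected_half_open_segment:
  fixes u v :: "'a::euclidean_space"
  shows "connected (closed_segment u v - {v})"
proof -
  have "v extreme_point_of closed_segment u v" by (simp add: extreme_point_of_segment)
  then show ?thesis
    using extreme_point_of_stillconvex convex_closed_segment convex_connected by blast
qed

section \<open>Edges at a vertex and the degree bound\<close>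

text \<open>Take a face through \<open>v\<close> of least positive dimension. In dimension 2 or
  more, \<open>{v}\<close> would lie in a facet of it, which is smaller but still of positive
  dimension. So the face is a segment with \<open>v\<close> as an end.\<close>

lemma vertex_has_edge:
  fixes P :: "'a::euclidean_space set"
  assumes P: "polytope P" and v: "v extreme_point_of P" and "aff_dim P \<ge> 1"
  obtains w where "closed_segment v w edge_of P"
proof -
  define D where "D F \<longleftrightarrow> F face_of P \<and> v \<in> F \<and> aff_dim F \<ge> 1" for F
  have "D P" using assms
    by (simp add: D_def face_of_refl polytope_imp_convex extreme_point_of_def)
  then obtain F where F: "D F" and min: "\<And>F'. D F' \<Longrightarrow> nat (aff_dim F) \<le> nat (aff_dim F')"
    using ex_has_least_nat[of D P "\<lambda>F. nat (aff_dim F)"] by blast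
  have Fp: "polytope F" using P F face_of_polytope_polytope D_def by blast
  have vF: "v extreme_point_of F" using F v extreme_point_of_face D_def by blast
  have dim: "aff_dim F = 1"
  proof (rule ccontr)
    assume "aff_dim F \<noteq> 1"
    then have d: "aff_dim F \<ge> 2" using F D_def by auto
    then have "{v} \<noteq> F" by auto
    moreover have "{v} face_of F" using vF by (simp add: face_of_singleton)
    ultimately obtain F' where F': "F' facet_of F" "{v} \<subseteq> F'"
      using face_of_polyhedron_subset_facet[of F "{v}"] polytope_imp_polyhedron[OF Fp] by blast
    then have "D F'" using F d unfolding D_def facet_of_def by (auto intro: face_of_trans)
    then have "nat (aff_dim F) \<le> nat (aff_dim F')" by (rule min)
    then show False using F' d unfolding facet_of_def by auto
  qed
  have "collinear F" using dim by (simp add: collinear_aff_dim)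
  moreover have "F \<noteq> {}" using F D_def by blast
  ultimately obtain x y where xy: "F = closed_segment x y"
    using compact_convex_collinear_segment[of F] Fp polytope_imp_compact polytope_imp_convex by metis
  have "v = x \<or> v = y" using vF by (simp add: xy extreme_point_of_segment)
  then have "\<exists>w. F = closed_segment v w" using xy closed_segment_commute by metis
  then show thesis using that F dim unfolding D_def edge_of_def by blast
qed

text \<open>With \<open>c\<close> exposing \<open>v\<close>, maximise the slope \<open>L u = (a \<bullet> u - b) / (e - c \<bullet> u)\<close> over the other
  vertices. The points of maximal slope form, together with \<open>v\<close>, a face on which \<open>a \<bullet> w > b\<close> away
  from \<open>v\<close>; any edge of this face at \<open>v\<close> will do.\<close>

lemma vertex_has_edge_above_hyperplane:
  fixes P :: "'a::euclidean_space set"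
  assumes P: "polytope P" and v: "v extreme_point_of P" and va: "a \<bullet> v = b"
    and x: "x \<in> P" "a \<bullet> x > b"
  obtains w where "closed_segment v w edge_of P" "a \<bullet> w > b"
proof -
  have cP: "convex P" "compact P" using P by (auto simp: polytope_imp_convex polytope_imp_compact)
  define V where "V = {u. u extreme_point_of P}"
  have hull: "P = convex hull V" unfolding V_def
    by (rule Krein_Milman_Minkowski) (use cP in auto)
  have finV: "finite V" unfolding V_def
    using P polytope_imp_polyhedron finite_polyhedron_extreme_points by blast
  \<comment> \<open>All faces of a polyhedron are exposed, so some linear functional
    \<open>c\<close> attains its maximum on \<open>P\<close> only at \<open>v\<close>.\<close>
  have "{v} exposed_face_of P"
    using v P by (simp add: exposed_face_of_polyhedron polytope_imp_polyhedron face_of_singleton)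
  then obtain c e where ce: "P \<subseteq> {x. c \<bullet> x \<le> e}" "{v} = P \<inter> {x. c \<bullet> x = e}"
    unfolding exposed_face_of_def by blast
  define L where "L u = (a \<bullet> u - b) / (e - c \<bullet> u)" for u
  have cv: "c \<bullet> v = e" using ce by blast
  have pos: "e - c \<bullet> u > 0" if "u \<in> P" "u \<noteq> v" for u
  proof -
    have "c \<bullet> u \<noteq> e" using ce that by blast
    moreover have "c \<bullet> u \<le> e" using ce that by blast
    ultimately show ?thesis by simp
  qed
  have VP: "V \<subseteq> P" by (auto simp: V_def extreme_point_of_def)
  have "\<exists>u\<in>V. a \<bullet> u > b"
  proof (rule ccontr)
    assume "\<not> (\<exists>u\<in>V. a \<bullet> u > b)"
    then have "convex hull V \<subseteq> {x. a \<bullet> x \<le> b}"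
      by (intro hull_minimal) (auto simp: convex_halfspace_le not_less)
    then show False using x hull by auto
  qed
  then obtain u0 where u0: "u0 \<in> V" "a \<bullet> u0 > b" by blast
  have u0v: "u0 \<noteq> v" using u0 va by auto
  have fin: "finite (L ` (V - {v}))" using finV by simp
  have "Max (L ` (V - {v})) \<in> L ` (V - {v})"
    by (rule Max_in[OF fin]) (use u0 u0v in auto)
  then obtain u where uV: "u \<in> V - {v}" and Lu: "L u = Max (L ` (V - {v}))" by (metis imageE)
  have u: "u \<in> V" "u \<noteq> v" using uV by auto
  have umax: "L u' \<le> L u" if "u' \<in> V - {v}" for u'
    unfolding Lu by (rule Max_ge[OF fin]) (use that in auto)
  define l where "l = L u"
  have "L u0 > 0" using u0 u0v pos VP by (auto simp: L_def)
  then have l: "l > 0" using umax[of u0] u0 u0v by (auto simp: l_def)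
  \<comment> \<open>The hyperplane at \<open>v\<close>, tilted until it supports \<open>P\<close>:
    for \<open>y \<noteq> v\<close> in \<open>P\<close>, the inequality
    \<open>a' \<bullet> y \<le> b'\<close> says \<open>L y \<le> l\<close>.\<close>
  define a' where "a' = a + l *\<^sub>R c"
  define b' where "b' = b + l * e"
  have le: "a' \<bullet> y \<le> b'" if "y \<in> P" for y
  proof -
    have "V \<subseteq> {y. a' \<bullet> y \<le> b'}"
    proof
      fix y assume y: "y \<in> V"
      show "y \<in> {y. a' \<bullet> y \<le> b'}"
      proof (cases "y = v")
        case True then show ?thesis using va cv by (simp add: a'_def b'_def inner_left_distrib)
      next
        case False
        then have "e - c \<bullet> y > 0" "L y \<le> l" using pos y VP umax by (auto simp: l_def)
        then have "a \<bullet> y - b \<le> l * (e - c \<bullet> y)" by (simp add: L_def pos_divide_le_eq)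
        then show ?thesis by (simp add: a'_def b'_def inner_left_distrib algebra_simps)
      qed
    qed
    then have "convex hull V \<subseteq> {y. a' \<bullet> y \<le> b'}"
      by (intro hull_minimal) (auto simp: convex_halfspace_le)
    then show ?thesis using that hull by auto
  qed
  define F where "F = P \<inter> {y. a' \<bullet> y = b'}"
  have F: "F face_of P" unfolding F_def
    by (rule face_of_Int_supporting_hyperplane_le) (use cP le in auto)
  have vF: "v \<in> F" using v va cv by (simp add: F_def a'_def b'_def inner_left_distrib extreme_point_of_def)
  have "e - c \<bullet> u > 0" using pos u VP by blast
  then have "a \<bullet> u - b = l * (e - c \<bullet> u)" by (simp add: l_def L_def)
  then have uF: "u \<in> F" using u VP by (auto simp add: F_def a'_def b'_def inner_left_distrib algebra_simps)
  have "aff_dim {u, v} \<le> aff_dim F" using uF vF by (intro aff_dim_subset) auto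
  then have "aff_dim F \<ge> 1" using u by (simp add: aff_dim_2)
  moreover have "polytope F" using P F face_of_polytope_polytope by blast
  moreover have "v extreme_point_of F" using F v vF extreme_point_of_face by blast
  ultimately obtain w where w: "closed_segment v w edge_of F" using vertex_has_edge by blast
  have "w \<noteq> v" using edge_segment_neq[OF w] by auto
  moreover have wF: "w \<in> F" using edge_of_imp_subset[OF w] by auto
  ultimately have "e - c \<bullet> w > 0" using pos F_def by auto
  moreover have "a \<bullet> w - b = l * (e - c \<bullet> w)"
    using wF by (auto simp add: F_def a'_def b'_def inner_left_distrib algebra_simps)
  ultimately have "a \<bullet> w > b" using l by (metis diff_gt_0_iff_gt mult_pos_pos)
  moreover have "closed_segment v w edge_of P"
    using w F face_of_trans unfolding edge_of_def by blast
  ultimately show thesis using that by blast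
qed

text \<open>\<open>P\<close> lies in the affine hull of \<open>v\<close> and its neighbours: a
  hyperplane containing this hull but missing a point \<open>x\<close> of \<open>P\<close> would be
  left, on the side of \<open>x\<close>, by some edge at \<open>v\<close>. The hull of
  \<open>v\<close> and \<open>n\<close> neighbours has dimension at most \<open>n\<close>.\<close>

lemma aff_dim_le_vertex_degree:
  fixes P :: "'a::euclidean_space set"
  assumes P: "polytope P" and v: "v extreme_point_of P"
    and fin: "finite {w. closed_segment v w edge_of P}"
  shows "aff_dim P \<le> int (card {w. closed_segment v w edge_of P})"
proof -
  define N where "N = {w. closed_segment v w edge_of P}"
  have "P \<subseteq> affine hull (insert v N)"
  proof (rule ccontr)
    assume "\<not> P \<subseteq> affine hull (insert v N)"
    then obtain x where x: "x \<in> P" "x \<notin> affine hull (insert v N)" by blast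
    define H where "H = affine hull (insert v N)"
    \<comment> \<open>An affine subspace is a finite intersection of hyperplanes, one of which
      misses \<open>x\<close>.\<close>
    obtain a b where ab: "a \<bullet> x \<noteq> b" "H \<subseteq> {y. a \<bullet> y = b}"
    proof -
      obtain K where K: "finite K" "H = \<Inter> K" "\<And>h. h \<in> K \<Longrightarrow> \<exists>a b. a \<noteq> 0 \<and> h = {y. a \<bullet> y = b}"
        using affine_hull_finite_intersection_hyperplanes[of "insert v N"] unfolding H_def by metis
      then obtain h where "h \<in> K" "x \<notin> h" using x unfolding H_def by blast
      then show thesis using K that by blast
    qed
    have vH: "a \<bullet> v = b" and NH: "\<And>w. w \<in> N \<Longrightarrow> a \<bullet> w = b"
      using ab(2) hull_subset[of "insert v N" affine] unfolding H_def by blast+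
    show False
    proof (cases "a \<bullet> x > b")
      case True
      then show False
        using vertex_has_edge_above_hyperplane[OF P v vH x(1)] NH unfolding N_def by force
    next
      case False
      then have "(- a) \<bullet> x > - b" using ab by simp
      then show False
        using vertex_has_edge_above_hyperplane[OF P v _ x(1), of "- a" "- b"] vH NH
        unfolding N_def by force
    qed
  qed
  then have "aff_dim P \<le> aff_dim (insert v N)"
    by (metis aff_dim_affine_hull aff_dim_subset)
  also have "\<dots> \<le> int (card (insert v N)) - 1"
    using fin N_def by (intro aff_dim_le_card) auto
  also have "\<dots> \<le> int (card N)" using fin card_insert_le_m1
    by (simp add: card_insert_if N_def)
  finally show ?thesis by (simp add: N_def)
qed

section \<open>Excluding a subdivision of K(3,3)\<close>

text \<open>The vertex \<open>p\<close> lies on none of the listed edges and serves as the point at infinity.\<close>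

lemma polytope_edges_no_K33_subdivision:
  fixes P :: "(real ^ 3) set"
  assumes P: "polytope P" "aff_dim P = 3" and p: "p extreme_point_of P"
    and dist: "distinct [p, a1, a2, a3, a4, b1, b3, b4, b5]"
    and E: "closed_segment a1 b3 edge_of P" "closed_segment a1 b4 edge_of P" "closed_segment a1 b5 edge_of P"
      "closed_segment a2 b3 edge_of P" "closed_segment a2 b4 edge_of P" "closed_segment a2 b5 edge_of P"
      "closed_segment a3 b4 edge_of P" "closed_segment a3 b5 edge_of P" "closed_segment a3 b1 edge_of P"
      "closed_segment a4 b1 edge_of P" "closed_segment a4 b3 edge_of P"
  shows False
proof -
  \<comment> \<open>Edges are proper faces, hence lie in the relative frontier, and a vertex on an
    edge is one of its ends.\<close>
  have sub: "closed_segment u v \<subseteq> rel_frontier P - {p}"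
    if e: "closed_segment u v edge_of P" and "p \<notin> {u, v}" for u v
  proof -
    have "closed_segment u v \<subseteq> rel_frontier P"
      using e P(2) by (intro face_of_subset_rel_frontier) (auto simp: edge_of_def)
    then show ?thesis using edge_segment_extreme_mem[OF e p] that(2) by blast
  qed
  have "{p} \<noteq> P"
  proof
    assume "{p} = P"
    from arg_cong[OF this, of aff_dim] show False using P(2) by simp
  qed
  then have "p \<in> rel_frontier P"
    using p face_of_subset_rel_frontier[of "{p}" P] by (simp add: face_of_singleton)
  \<comment> \<open>The frontier of \<open>P\<close> is a topological sphere, so puncturing it at
    \<open>p\<close> leaves a plane.\<close>
  then have "rel_frontier P - {p} homeomorphic (UNIV :: complex set)"
    using P by (intro homeomorphic_punctured_sphere_affine_gen)
      (auto simp: polytope_imp_convex polytope_imp_bounded)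
  then obtain h h' where h: "homeomorphism (rel_frontier P - {p}) (UNIV :: complex set) h h'"
    unfolding homeomorphic_def by blast
  define X where "X = rel_frontier P - {p}"
  have hX: "continuous_on X h" "inj_on h X"
    using h unfolding X_def by (auto simp: homeomorphism_def intro: inj_on_inverseI)
  \<comment> \<open>The arms of the theta curve, for \<open>b\<close> among \<open>b3\<close>,
    \<open>b4\<close>, \<open>b5\<close>.\<close>
  define c where "c b = linepath a1 b +++ linepath b a2" for b
  have c: "path_image (c b) = closed_segment a1 b \<union> closed_segment b a2" for b
    by (simp add: c_def path_image_join)
  have E': "closed_segment b3 a2 edge_of P" "closed_segment b4 a2 edge_of P" "closed_segment b5 a2 edge_of P"
    "closed_segment b1 a4 edge_of P"
    using E by (simp_all add: closed_segment_commute)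
  have cX: "path_image (c b) \<subseteq> X" if "b \<in> {b3, b4, b5}" for b
    using that E E' dist sub unfolding c X_def by auto
  have arc: "simple_path (c b)" if b: "b \<in> {b3, b4, b5}" for b
  proof -
    have e: "closed_segment a1 b edge_of P" "closed_segment b a2 edge_of P" using b E E' by auto
    have "closed_segment a1 b \<inter> closed_segment b a2 \<subseteq> {a1, b} \<inter> {b, a2}"
      using edge_segment_Int[OF e] dist b by (auto simp: doubleton_eq_iff)
    then have "arc (c b)" unfolding c_def using b dist
      by (intro arc_join) auto
    then show ?thesis by (rule arc_imp_simple_path)
  qed
  have cc: "path_image (c b) \<inter> path_image (c b') = {a1, a2}"
    if b: "b \<in> {b3, b4, b5}" "b' \<in> {b3, b4, b5}" "b \<noteq> b'" for b b'
  proof -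
    have e: "closed_segment a1 b edge_of P" "closed_segment b a2 edge_of P"
      "closed_segment a1 b' edge_of P" "closed_segment b' a2 edge_of P" using b E E' by auto
    have bd: "b \<notin> {a1, a2}" "b' \<notin> {a1, a2}" "a1 \<noteq> a2" using b dist by auto
    have "closed_segment a1 b \<inter> closed_segment a1 b' \<subseteq> {a1, b} \<inter> {a1, b'}"
      "closed_segment a1 b \<inter> closed_segment b' a2 \<subseteq> {a1, b} \<inter> {b', a2}"
      "closed_segment b a2 \<inter> closed_segment a1 b' \<subseteq> {b, a2} \<inter> {a1, b'}"
      "closed_segment b a2 \<inter> closed_segment b' a2 \<subseteq> {b, a2} \<inter> {b', a2}"
      by (rule edge_segment_Int; use e bd b in \<open>auto simp: doubleton_eq_iff\<close>)+
    then have "path_image (c b) \<inter> path_image (c b') \<subseteq> {a1, a2}" unfolding c using bd b by blast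
    then show ?thesis unfolding c by auto
  qed
  \<comment> \<open>\<open>R\<close> is the third hub of the \<open>K\<^sub>3\<^sub>,\<^sub>3\<close>: it reaches \<open>b3\<close> via \<open>b1\<close> and \<open>a4\<close> because, in the
    intended application, \<open>a3\<close> and \<open>b3\<close> are the one non-adjacent pair.\<close>
  define M where "M = closed_segment a3 b1 \<union> closed_segment b1 a4"
  define R where "R = (closed_segment a3 b4 - {b4}) \<union> (closed_segment a3 b5 - {b5}) \<union> M \<union> (closed_segment a4 b3 - {b3})"
  have RX: "R \<subseteq> X" 
    using E E' dist sub[OF E(7)] sub[OF E(8)] sub[OF E(9)] sub[OF E'(4)] sub[OF E(11)]
    unfolding R_def M_def X_def by auto
  have conM: "connected M" unfolding M_def
    by (intro connected_Un) auto
  have un: "connected (A \<union> B)" if "connected A" "connected B" "x \<in> A" "x \<in> B" for A B :: "(real^3) set" and x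
    using that by (intro connected_Un) auto
  have half: "connected (closed_segment u v - {v})" for u v :: "real^3"
    by (rule connected_half_open_segment)
  have a3M: "a3 \<in> M" "a4 \<in> M" by (auto simp: M_def)
  have star: "connected (A \<union> B \<union> M \<union> D)"
    if "connected A" "connected B" "connected D" "a3 \<in> A" "a3 \<in> B" "a4 \<in> D" for A B D
    using that a3M un[OF un[OF un[OF that(1,2)] conM] that(3)] by blast
  have conR: "connected R" unfolding R_def
    using dist by (intro star half) auto
  \<comment> \<open>\<open>R\<close> omits the ends \<open>b3\<close>, \<open>b4\<close>,
    \<open>b5\<close> to stay off the theta curve; putting one back closes a half-open segment, so
    \<open>R\<close> borders that arm.\<close>
  have conb4: "connected (insert b4 R)"
  proof -
    have "insert b4 R = closed_segment a3 b4 \<union> (closed_segment a3 b5 - {b5}) \<union> M \<union> (closed_segment a4 b3 - {b3})"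
      unfolding R_def by auto
    then show ?thesis using dist by (auto intro!: star half)
  qed
  have conb5: "connected (insert b5 R)"
  proof -
    have "insert b5 R = (closed_segment a3 b4 - {b4}) \<union> closed_segment a3 b5 \<union> M \<union> (closed_segment a4 b3 - {b3})"
      unfolding R_def by auto
    then show ?thesis using dist by (auto intro!: star half)
  qed
  have conb3: "connected (insert b3 R)"
  proof -
    have "insert b3 R = (closed_segment a3 b4 - {b4}) \<union> (closed_segment a3 b5 - {b5}) \<union> M \<union> closed_segment a4 b3"
      unfolding R_def by auto
    then show ?thesis using dist by (auto intro!: star half)
  qed
  have Rc: "R \<inter> path_image (c b) = {}" if b: "b \<in> {b3, b4, b5}" for b
  proof -
    have e: "closed_segment a1 b edge_of P" "closed_segment b a2 edge_of P" using b E E' by auto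
    have sep: "closed_segment u v \<inter> path_image (c b) \<subseteq> {v} \<inter> {b}"
      if uv: "closed_segment u v edge_of P" and "u \<notin> {a1, a2, b}" "v \<notin> {a1, a2}" for u v
    proof -
      have "closed_segment u v \<inter> closed_segment a1 b \<subseteq> {u, v} \<inter> {a1, b}"
        by (rule edge_segment_Int[OF uv e(1)]) (use that in \<open>auto simp: doubleton_eq_iff\<close>)
      moreover have "closed_segment u v \<inter> closed_segment b a2 \<subseteq> {u, v} \<inter> {b, a2}"
        by (rule edge_segment_Int[OF uv e(2)]) (use that in \<open>auto simp: doubleton_eq_iff\<close>)
      ultimately show ?thesis using that(2,3) unfolding c by blast
    qed
    have "closed_segment a3 b4 \<inter> path_image (c b) \<subseteq> {b4}" 
      "closed_segment a3 b5 \<inter> path_image (c b) \<subseteq> {b5}"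
      "closed_segment a3 b1 \<inter> path_image (c b) \<subseteq> {b1} \<inter> {b}"
      "closed_segment b1 a4 \<inter> path_image (c b) \<subseteq> {a4} \<inter> {b}"
      "closed_segment a4 b3 \<inter> path_image (c b) \<subseteq> {b3}"
      using sep[OF E(7)] sep[OF E(8)] sep[OF E(9)] sep[OF E'(4)] sep[OF E(11)] dist b by auto
    \<comment> \<open>The intersections at \<open>b1\<close> and \<open>a4\<close> are empty, and
      the remaining possible common points are the ends removed from \<open>R\<close>.\<close>
    moreover have "b \<noteq> b1" "b \<noteq> a4" using b dist by auto
    ultimately show ?thesis unfolding R_def M_def by blast
  qed
  have img: "h ` A \<inter> h ` B = h ` (A \<inter> B)" if "A \<subseteq> X" "B \<subseteq> X" for A B
    using inj_on_image_Int[OF hX(2) that] by simp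
  have conn: "connected (h ` A)" if "connected A" "A \<subseteq> X" for A
    using that connected_continuous_image continuous_on_subset[OF hX(1)] by blast
  have ends: "pathstart (c b) = a1" "pathfinish (c b) = a2" for b by (simp_all add: c_def)
  have ab: "a1 \<in> X" "a2 \<in> X" "b3 \<in> X" "b4 \<in> X" "b5 \<in> X"
    using cX[of b3] cX[of b4] cX[of b5] unfolding c by auto
  have simple: "simple_path (h \<circ> c b)" if "b \<in> {b3, b4, b5}" for b
    using arc[OF that] cX[OF that] hX
    by (intro simple_path_continuous_image) (auto intro: continuous_on_subset inj_on_subset)
  have cc': "path_image (h \<circ> c b) \<inter> path_image (h \<circ> c b') = {h a1, h a2}"
    if "b \<in> {b3, b4, b5}" "b' \<in> {b3, b4, b5}" "b \<noteq> b'" for b b'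
    using cc[OF that] img[OF cX cX] that unfolding path_image_compose by simp
  have mem: "h b \<in> path_image (h \<circ> c b) - {h a1, h a2}" if b: "b \<in> {b3, b4, b5}" for b
  proof -
    have "b \<in> path_image (c b)" unfolding c by simp
    moreover have "h b \<noteq> h a1" "h b \<noteq> h a2"
      using b dist ab hX(2) by (auto simp: inj_on_eq_iff)
    ultimately show ?thesis unfolding path_image_compose by blast
  qed
  have hR: "h ` R \<inter> path_image (h \<circ> c b) = {}" if "b \<in> {b3, b4, b5}" for b
    using img[OF RX cX[OF that]] Rc[OF that] unfolding path_image_compose by simp
  have conh: "connected (insert (h b) (h ` R))" if "connected (insert b R)" "b \<in> X" for b
    using conn[OF that(1)] RX that(2) by simp
  show False
  proof (rule theta_curve_no_common_component)
    show "simple_path (h \<circ> c b3)" "simple_path (h \<circ> c b4)" "simple_path (h \<circ> c b5)"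
      using simple by auto
    show "pathstart (h \<circ> c b3) = h a1" "pathfinish (h \<circ> c b3) = h a2"
      "pathstart (h \<circ> c b4) = h a1" "pathfinish (h \<circ> c b4) = h a2"
      "pathstart (h \<circ> c b5) = h a1" "pathfinish (h \<circ> c b5) = h a2"
      by (simp_all add: pathstart_compose pathfinish_compose ends)
    show "h a1 \<noteq> h a2" using ab dist hX(2) by (auto simp: inj_on_eq_iff)
    show "path_image (h \<circ> c b3) \<inter> path_image (h \<circ> c b4) = {h a1, h a2}"
      "path_image (h \<circ> c b3) \<inter> path_image (h \<circ> c b5) = {h a1, h a2}"
      "path_image (h \<circ> c b4) \<inter> path_image (h \<circ> c b5) = {h a1, h a2}"
      using cc' dist by auto
    show "h ` R \<noteq> {}" using a3M by (auto simp: R_def)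
    show "connected (h ` R)" using conn[OF conR RX] .
    show "h ` R \<inter> (path_image (h \<circ> c b3) \<union> path_image (h \<circ> c b4) \<union> path_image (h \<circ> c b5)) = {}"
      using hR by blast
    show "h b3 \<in> path_image (h \<circ> c b3) - {h a1, h a2}" "h b4 \<in> path_image (h \<circ> c b4) - {h a1, h a2}"
      "h b5 \<in> path_image (h \<circ> c b5) - {h a1, h a2}"
      using mem by auto
    show "connected (insert (h b3) (h ` R))" "connected (insert (h b4) (h ` R))"
      "connected (insert (h b5) (h ` R))"
      using conh conb3 conb4 conb5 ab by auto
  qed
qed


section \<open>Complete bipartite graphs minus a perfect matching\<close>

lemma graph_isomorphic_sym:
  assumes "graph_isomorphic G H"
  shows "graph_isomorphic H G"
proof -
  obtain h where h: "bij_betw h (vertices G) (vertices H)"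
    and e: "\<forall>x\<in>vertices G. \<forall>y\<in>vertices G. {x, y} \<in> edges G \<longleftrightarrow> {h x, h y} \<in> edges H"
    using assms unfolding graph_isomorphic_def by blast
  define g where "g = inv_into (vertices G) h"
  have g: "bij_betw g (vertices H) (vertices G)" unfolding g_def by (rule bij_betw_inv_into[OF h])
  have hg: "h (g x) = x" if "x \<in> vertices H" for x
    unfolding g_def using bij_betw_inv_into_right[OF h that] .
  have "{x, y} \<in> edges H \<longleftrightarrow> {g x, g y} \<in> edges G" if "x \<in> vertices H" "y \<in> vertices H" for x y
    using e hg that bij_betwE[OF g] by auto
  then show ?thesis using g unfolding graph_isomorphic_def by blast
qed

lemma graph_isomorphic_trans:
  assumes "graph_isomorphic G H" "graph_isomorphic H K"
  shows "graph_isomorphic G K"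
proof -
  obtain h where h: "bij_betw h (vertices G) (vertices H)"
    and e: "\<forall>x\<in>vertices G. \<forall>y\<in>vertices G. {x, y} \<in> edges G \<longleftrightarrow> {h x, h y} \<in> edges H"
    using assms(1) unfolding graph_isomorphic_def by blast
  obtain g where g: "bij_betw g (vertices H) (vertices K)"
    and e': "\<forall>x\<in>vertices H. \<forall>y\<in>vertices H. {x, y} \<in> edges H \<longleftrightarrow> {g x, g y} \<in> edges K"
    using assms(2) unfolding graph_isomorphic_def by blast
  have "bij_betw (g \<circ> h) (vertices G) (vertices K)" using h g by (rule bij_betw_trans)
  moreover have "\<forall>x\<in>vertices G. \<forall>y\<in>vertices G. {x, y} \<in> edges G \<longleftrightarrow> {(g \<circ> h) x, (g \<circ> h) y} \<in> edges K"
    using e e' bij_betwE[OF h] by auto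
  ultimately show ?thesis unfolding graph_isomorphic_def by blast
qed

section \<open>Non-adjacency as a perfect matching\<close>

text \<open>Every vertex misses exactly one vertex of the other class; \<open>\<phi> v\<close> is
  the one missed by \<open>v\<close>. It is injective because \<open>\<phi> v\<close> in turn misses
  only one vertex of \<open>A\<close>.\<close>

lemma regular_bipartite_complement_matching:
  fixes E :: "'v set set"
  assumes k: "k > 0" and card: "card A = k" "card B = k"
    and degA: "\<And>v. v \<in> A \<Longrightarrow> card {w \<in> B. {v, w} \<in> E} = k - 1"
    and degB: "\<And>w. w \<in> B \<Longrightarrow> card {v \<in> A. {v, w} \<in> E} = k - 1"
  obtains \<phi> where "bij_betw \<phi> A B" "\<And>v w. v \<in> A \<Longrightarrow> w \<in> B \<Longrightarrow> {v, w} \<in> E \<longleftrightarrow> w \<noteq> \<phi> v"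
proof -
  have fin: "finite A" "finite B" by (rule card_ge_0_finite; simp add: k card)+
  \<comment> \<open>Positivity of \<open>k\<close> matters: only then is
    \<open>k - (k - 1) = 1\<close> for natural numbers.\<close>
  have single: "\<exists>y. {y \<in> Y. \<not> R y} = {y}" if "finite Y" "card Y = k" "card {y \<in> Y. R y} = k - 1" for Y and R :: "'v \<Rightarrow> bool"
  proof -
    have "{y \<in> Y. \<not> R y} = Y - {y \<in> Y. R y}" by blast
    then have "card {y \<in> Y. \<not> R y} = card Y - card {y \<in> Y. R y}"
      using that(1) by (simp add: card_Diff_subset)
    then have "card {y \<in> Y. \<not> R y} = 1" using that k by simp
    then show ?thesis by (auto simp: card_1_singleton_iff)
  qed
  have "\<forall>v\<in>A. \<exists>w. {y \<in> B. {v, y} \<notin> E} = {w}"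
  proof
    fix v assume "v \<in> A"
    show "\<exists>w. {y \<in> B. {v, y} \<notin> E} = {w}"
      by (rule single[OF fin(2) card(2) degA[OF \<open>v \<in> A\<close>]])
  qed
  then obtain \<phi> where \<phi>: "\<And>v. v \<in> A \<Longrightarrow> {y \<in> B. {v, y} \<notin> E} = {\<phi> v}" by metis
  have iff: "{v, w} \<in> E \<longleftrightarrow> w \<noteq> \<phi> v" if "v \<in> A" "w \<in> B" for v w using \<phi>[OF that(1)] that(2) by blast
  have mem: "\<phi> v \<in> B" if "v \<in> A" for v using \<phi>[OF that] by blast
  have "inj_on \<phi> A"
  proof (rule inj_onI)
    fix v v' assume v: "v \<in> A" "v' \<in> A" "\<phi> v = \<phi> v'"
    obtain u where u: "{y \<in> A. {y, \<phi> v} \<notin> E} = {u}"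
      using single[OF fin(1) card(1) degB[OF mem[OF v(1)]]] by blast
    have m: "v \<in> {y \<in> A. {y, \<phi> v} \<notin> E}" "v' \<in> {y \<in> A. {y, \<phi> v} \<notin> E}"
      using v iff mem by auto
    show "v = v'" using m[unfolded u] by simp
  qed
  moreover have "\<phi> ` A = B"
    by (rule card_subset_eq) (use fin mem card card_image[OF \<open>inj_on \<phi> A\<close>] in auto)
  ultimately have "bij_betw \<phi> A B" by (simp add: bij_betw_def)
  then show thesis using that iff by blast
qed

section \<open>The crown graph on eight vertices and the cube graph\<close>

text \<open>Makes Hamming distances in dimension 3 computable as sums of three truth values.\<close>

lemma card_Collect_3:
  fixes Q :: "3 \<Rightarrow> bool"
  shows "card {i. Q i} = of_bool (Q 1) + of_bool (Q 2) + of_bool (Q 3)"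
proof -
  have "{i. Q i} = (if Q 1 then {1} else {}) \<union> (if Q 2 then {2} else {}) \<union> (if Q 3 then {3} else {})"
    (is "?L = ?R")
  proof (rule set_eqI)
    fix i show "i \<in> ?L \<longleftrightarrow> i \<in> ?R" using exhaust_3[of i] by auto
  qed
  then show ?thesis by simp
qed

lemma cube_graph_edge_iff:
  assumes "x \<in> vertices cube_graph" "y \<in> vertices cube_graph"
  shows "{x, y} \<in> edges cube_graph \<longleftrightarrow> card {i. x $ i \<noteq> y $ i} = 1"
proof
  assume "{x, y} \<in> edges cube_graph"
  then obtain u v where uv: "{x, y} = {u, v}" "card {i. u $ i \<noteq> v $ i} = 1"
    unfolding cube_graph_def by auto
  have "{i. u $ i \<noteq> v $ i} = {i. v $ i \<noteq> u $ i}" by auto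
  then show "card {i. x $ i \<noteq> y $ i} = 1" using uv by (auto simp: doubleton_eq_iff)
qed (use assms in \<open>auto simp: cube_graph_def\<close>)

text \<open>Any bijection from \<open>A\<close> to the even vertices of the cube extends to
  \<open>B\<close> by sending \<open>\<phi> v\<close> to the antipode of the image of
  \<open>v\<close>; non-adjacent partners then correspond to antipodes.\<close>

lemma crown_graph_4_isomorphic_cube_graph:
  fixes G :: "'v ugraph"
  assumes G: "bipartition G A B" and A: "card A = 4" and \<phi>: "bij_betw \<phi> A B"
    and adj: "\<And>v w. v \<in> A \<Longrightarrow> w \<in> B \<Longrightarrow> {v, w} \<in> edges G \<longleftrightarrow> w \<noteq> \<phi> v"
  shows "graph_isomorphic G cube_graph"
proof -
  \<comment> \<open>In the cube, a vertex of even weight is adjacent to every vertex of odd weight but its antipode.\<close>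
  define Ev :: "(nat ^ 3) set" where
    "Ev = {vector [0, 0, 0], vector [0, 1, 1], vector [1, 0, 1], vector [1, 1, 0]}"
  \<comment> \<open>On \<open>{0, 1}\<close> the truncated subtraction \<open>1 - x $ i\<close>
    flips the coordinate.\<close>
  define ant :: "nat ^ 3 \<Rightarrow> nat ^ 3" where "ant x = (\<chi> i. 1 - x $ i)" for x
  note vs = vec_eq_iff forall_3 vector_3
  have cardEv: "card Ev = 4" unfolding Ev_def by (simp add: vs)
  have ant_nth [simp]: "ant x $ i = 1 - x $ i" for x i by (simp add: ant_def)
  have V: "vertices cube_graph = Ev \<union> ant ` Ev"
  proof
    show "vertices cube_graph \<subseteq> Ev \<union> ant ` Ev"
    proof
      fix x :: "nat ^ 3" assume "x \<in> vertices cube_graph"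
      then have "x $ 1 \<in> {0, 1}" "x $ 2 \<in> {0, 1}" "x $ 3 \<in> {0, 1}" by (auto simp: cube_graph_def)
      then show "x \<in> Ev \<union> ant ` Ev" unfolding Ev_def by (auto simp: vs)
    qed
    show "Ev \<union> ant ` Ev \<subseteq> vertices cube_graph" by (auto simp: cube_graph_def Ev_def vs)
  qed
  have disj: "Ev \<inter> ant ` Ev = {}" unfolding Ev_def by (auto simp: vs)
  have inj_ant: "inj_on ant Ev" unfolding Ev_def by (auto simp: inj_on_def vs)
  \<comment> \<open>Two even vertices are at distance 0 or 2, and so are their antipodes; an even
    vertex and the antipode of another are at distance 1, or 3 if the two even vertices
    coincide.\<close>
  have e1: "card {i. x $ i \<noteq> y $ i} \<noteq> 1" "card {i. ant x $ i \<noteq> ant y $ i} \<noteq> 1"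
    "card {i. x $ i \<noteq> ant y $ i} = 1 \<longleftrightarrow> x \<noteq> y"
    "card {i. ant x $ i \<noteq> y $ i} = 1 \<longleftrightarrow> x \<noteq> y"
    if "x \<in> Ev" "y \<in> Ev" for x y
    using that unfolding Ev_def
    by (elim insertE emptyE; simp add: card_Collect_3 vs)+
  have finA: "finite A" by (rule card_ge_0_finite) (simp add: A)
  have "finite Ev" by (simp add: Ev_def)
  then have "\<exists>h. bij_betw h A Ev"
    by (rule finite_same_card_bij[OF finA]) (simp add: A cardEv)
  then obtain h0 where h0: "bij_betw h0 A Ev" by blast
  define h where "h v = (if v \<in> A then h0 v else ant (h0 (inv_into A \<phi> v)))" for v
  have GV: "vertices G = A \<union> B" "A \<inter> B = {}" using G by (auto simp: bipartition_def)
  have hA: "h v = h0 v" if "v \<in> A" for v using that by (simp add: h_def)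
  have hB: "h (\<phi> v) = ant (h0 v)" if "v \<in> A" for v
  proof -
    have "\<phi> v \<notin> A" using GV(2) bij_betwE[OF \<phi>] that by blast
    then show ?thesis using bij_betw_inv_into_left[OF \<phi> that] by (simp add: h_def)
  qed
  have "bij_betw h A Ev"
    by (subst bij_betw_cong[where g = h0]) (simp_all add: h0 hA)
  moreover have "bij_betw h B (ant ` Ev)"
  proof -
    have "bij_betw (ant \<circ> h0 \<circ> inv_into A \<phi>) B (ant ` Ev)"
      using bij_betw_trans[OF bij_betw_inv_into[OF \<phi>] bij_betw_trans[OF h0 inj_on_imp_bij_betw[OF inj_ant]]]
      by (simp add: comp_assoc)
    moreover have "h v = (ant \<circ> h0 \<circ> inv_into A \<phi>) v" if "v \<in> B" for v
      using that GV(2) by (auto simp: h_def)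
    ultimately show ?thesis by (subst bij_betw_cong) simp_all
  qed
  ultimately have bij: "bij_betw h (vertices G) (vertices cube_graph)"
    unfolding GV V using disj by (rule bij_betw_combine)
  have in_edges: "\<exists>a\<in>A. \<exists>b\<in>B. {x, y} = {a, b}" if "{x, y} \<in> edges G" for x y
    using G that unfolding bipartition_def by blast
  have "{x, y} \<in> edges G \<longleftrightarrow> {h x, h y} \<in> edges cube_graph"
    if xy: "x \<in> vertices G" "y \<in> vertices G" for x y
  proof -
    have rhs: "{h x, h y} \<in> edges cube_graph \<longleftrightarrow> card {i. h x $ i \<noteq> h y $ i} = 1"
      using bij_betwE[OF bij] xy by (intro cube_graph_edge_iff) auto
    have h0E: "h0 v \<in> Ev" if "v \<in> A" for v using bij_betwE[OF h0] that by blast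
    have h0i: "h0 v = h0 w \<longleftrightarrow> v = w" if "v \<in> A" "w \<in> A" for v w
      using h0 that by (auto simp: bij_betw_def inj_on_eq_iff)
    have \<phi>i: "\<phi> v = \<phi> w \<longleftrightarrow> v = w" if "v \<in> A" "w \<in> A" for v w
      using \<phi> that by (auto simp: bij_betw_def inj_on_eq_iff)
    have \<phi>B: "\<phi> v \<in> B" if "v \<in> A" for v using bij_betwE[OF \<phi>] that by blast
    have cases: "v \<in> A \<or> (\<exists>w\<in>A. v = \<phi> w)" if "v \<in> vertices G" for v
      using that \<phi> GV by (auto simp: bij_betw_def)
    consider (AA) "x \<in> A" "y \<in> A" | (AB) w where "x \<in> A" "w \<in> A" "y = \<phi> w"
      | (BA) v where "v \<in> A" "x = \<phi> v" "y \<in> A" | (BB) v w where "v \<in> A" "w \<in> A" "x = \<phi> v" "y = \<phi> w"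
      using cases[OF xy(1)] cases[OF xy(2)] by blast
    then show ?thesis
    proof cases
      case AA
      then have "{x, y} \<notin> edges G" using in_edges GV(2) by (fastforce simp: doubleton_eq_iff)
      moreover have "card {i. h x $ i \<noteq> h y $ i} \<noteq> 1"
        unfolding hA[OF AA(1)] hA[OF AA(2)] by (rule e1(1)[OF h0E[OF AA(1)] h0E[OF AA(2)]])
      ultimately show ?thesis using rhs by blast
    next
      case AB
      have "{x, y} \<in> edges G \<longleftrightarrow> x \<noteq> w"
        using adj[OF AB(1) \<phi>B[OF AB(2)]] \<phi>i[OF AB(2,1)] AB(3) by auto
      moreover have "card {i. h x $ i \<noteq> h y $ i} = 1 \<longleftrightarrow> x \<noteq> w"
        unfolding AB(3) hA[OF AB(1)] hB[OF AB(2)] h0i[OF AB(1,2), symmetric]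
        by (rule e1(3)[OF h0E[OF AB(1)] h0E[OF AB(2)]])
      ultimately show ?thesis using rhs by blast
    next
      case BA
      have "{x, y} \<in> edges G \<longleftrightarrow> v \<noteq> y"
        using adj[OF BA(3) \<phi>B[OF BA(1)]] \<phi>i[OF BA(1,3)] BA(2) by (simp add: insert_commute)
      moreover have "card {i. h x $ i \<noteq> h y $ i} = 1 \<longleftrightarrow> v \<noteq> y"
        unfolding BA(2) hA[OF BA(3)] hB[OF BA(1)] h0i[OF BA(1,3), symmetric]
        by (rule e1(4)[OF h0E[OF BA(1)] h0E[OF BA(3)]])
      ultimately show ?thesis using rhs by blast
    next
      case BB
      then have "{x, y} \<notin> edges G" using in_edges GV(2) \<phi>B by (fastforce simp: doubleton_eq_iff)
      moreover have "card {i. h x $ i \<noteq> h y $ i} \<noteq> 1"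
        unfolding BB(3,4) hB[OF BB(1)] hB[OF BB(2)] by (rule e1(2)[OF h0E[OF BB(1)] h0E[OF BB(2)]])
      ultimately show ?thesis using rhs by blast
    qed
  qed
  then show ?thesis using bij unfolding graph_isomorphic_def by blast
qed


section \<open>The unit cube\<close>

text \<open>A proper convex combination of two numbers in \<open>[0, 1]\<close> reaches 0 or 1 only
  if both numbers do.\<close>

lemma open_segment_component_at_bound:
  fixes a b :: "real ^ 'n"
  assumes z: "z \<in> open_segment a b" and ab: "a \<in> cbox 0 1" "b \<in> cbox 0 1" and i: "z $ i \<in> {0, 1}"
  shows "a $ i = z $ i \<and> b $ i = z $ i"
proof -
  obtain u where u: "0 < u" "u < 1" "z = (1 - u) *\<^sub>R a + u *\<^sub>R b"
    using z by (auto simp: in_segment)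
  have zi: "z $ i = (1 - u) * a $ i + u * b $ i" using u by simp
  have bounds: "0 \<le> a $ i" "a $ i \<le> 1" "0 \<le> b $ i" "b $ i \<le> 1"
    using ab by (auto simp: mem_box_cart)
  consider "z $ i = 0" | "z $ i = 1" using i by auto
  then show ?thesis
  proof cases
    case 1
    then have "(1 - u) * a $ i + u * b $ i = 0" using zi by simp
    moreover have "(1 - u) * a $ i \<ge> 0" "u * b $ i \<ge> 0" using u bounds by auto
    ultimately have "(1 - u) * a $ i = 0" "u * b $ i = 0" by linarith+
    then show ?thesis using 1 u by auto
  next
    case 2
    then have "(1 - u) * (1 - a $ i) + u * (1 - b $ i) = 0" using zi by (simp add: algebra_simps)
    moreover have "(1 - u) * (1 - a $ i) \<ge> 0" "u * (1 - b $ i) \<ge> 0" using u bounds by auto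
    ultimately have "(1 - u) * (1 - a $ i) = 0" "u * (1 - b $ i) = 0" by linarith+
    then show ?thesis using 2 u by auto
  qed
qed

text \<open>A point with a coordinate strictly between 0 and 1 is the midpoint of two cube points
  obtained by shifting that coordinate. A point with all coordinates at bounds forces both ends of
  an open segment through it to equal it.\<close>

lemma extreme_point_of_unit_cube:
  fixes x :: "real ^ 'n"
  shows "x extreme_point_of cbox 0 1 \<longleftrightarrow> (\<forall>i. x $ i \<in> {0, 1})"
proof
  assume x: "x extreme_point_of cbox 0 1"
  then have xQ: "x \<in> cbox 0 1" by (simp add: extreme_point_of_def)
  show "\<forall>i. x $ i \<in> {0, 1}"
  proof (rule ccontr)
    assume "\<not> (\<forall>i. x $ i \<in> {0, 1})"
    then obtain i where "x $ i \<noteq> 0" "x $ i \<noteq> 1" by auto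
    moreover have "0 \<le> x $ i" "x $ i \<le> 1" using xQ by (auto simp: mem_box_cart)
    ultimately have i: "0 < x $ i" "x $ i < 1" by auto
    \<comment> \<open>The distance from the coordinate to the nearer bound, so both shifts stay in
      the cube.\<close>
    define d where "d = min (x $ i) (1 - x $ i)"
    have d: "d > 0" "d \<le> x $ i" "d \<le> 1 - x $ i" using i by (auto simp: d_def)
    define a where "a = x - axis i d"
    define b where "b = x + axis i d"
    have "a $ i \<noteq> b $ i" using d by (simp add: a_def b_def axis_def)
    then have "a \<noteq> b" by auto
    then have "midpoint a b \<in> open_segment a b" by simp
    moreover have "midpoint a b = x" by (simp add: midpoint_def a_def b_def vec_eq_iff)
    moreover have "a \<in> cbox 0 1" "b \<in> cbox 0 1"
      using xQ d by (auto simp: mem_box_cart a_def b_def axis_def)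
    ultimately show False using x by (auto simp: extreme_point_of_def)
  qed
next
  assume x: "\<forall>i. x $ i \<in> {0, 1}"
  have "x \<in> cbox 0 1" unfolding mem_box_cart
  proof
    fix i show "0 $ i \<le> x $ i \<and> x $ i \<le> 1 $ i" using x[rule_format, of i] by auto
  qed
  moreover have "x \<notin> open_segment a b" if ab: "a \<in> cbox 0 1" "b \<in> cbox 0 1" for a b
  proof
    assume z: "x \<in> open_segment a b"
    then have "a = b" using open_segment_component_at_bound[OF z ab] x by (metis vec_eq_iff)
    then show False using z by simp
  qed
  ultimately show "x extreme_point_of cbox 0 1" by (simp add: extreme_point_of_def)
qed

text \<open>If two coordinates differ, exchanging one of them between \<open>x\<close> and
  \<open>y\<close> yields another segment with the same midpoint, which contradicts the face
  property. If only coordinate \<open>i\<close> differs, the segment consists of the cube points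
  that agree with \<open>x\<close> off \<open>i\<close>; there \<open>x\<close> is at bounds, which
  makes it a face.\<close>

lemma edge_of_unit_cube_iff:
  fixes x y :: "real ^ 'n"
  assumes x: "\<forall>i. x $ i \<in> {0, 1}" and y: "\<forall>i. y $ i \<in> {0, 1}"
  shows "closed_segment x y edge_of cbox 0 1 \<longleftrightarrow> card {i. x $ i \<noteq> y $ i} = 1"
proof
  have xyQ: "x \<in> cbox 0 1" "y \<in> cbox 0 1"
    using x y extreme_point_of_unit_cube extreme_point_of_def by blast+
  {
    assume e: "closed_segment x y edge_of cbox 0 1"
    then have "x \<noteq> y" by (auto simp: edge_of_def)
    then obtain i where i: "x $ i \<noteq> y $ i" by (auto simp: vec_eq_iff)
    have "{i. x $ i \<noteq> y $ i} = {i}"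
    proof (rule ccontr)
      assume "{i. x $ i \<noteq> y $ i} \<noteq> {i}"
      then obtain j where j: "j \<noteq> i" "x $ j \<noteq> y $ j" using i by auto
      define x' where "x' = (\<chi> k. if k = i then y $ k else x $ k)"
      define y' where "y' = (\<chi> k. if k = i then x $ k else y $ k)"
      have "x' $ j \<noteq> y' $ j" using j by (simp add: x'_def y'_def)
      then have "x' \<noteq> y'" by auto
      then have o: "midpoint x' y' \<in> open_segment x' y'" by simp
      have "midpoint x' y' = midpoint x y"
        by (simp add: midpoint_def x'_def y'_def vec_eq_iff)
      then have m: "midpoint x' y' \<in> closed_segment x y" by simp
      have Q: "x' \<in> cbox 0 1" "y' \<in> cbox 0 1"
        using xyQ by (auto simp: mem_box_cart x'_def y'_def)
      have "closed_segment x y face_of cbox 0 1" using e by (simp add: edge_of_def)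
      then have "x' \<in> closed_segment x y" using face_ofD[OF _ o Q m] by blast
      then obtain u where u: "x' = (1 - u) *\<^sub>R x + u *\<^sub>R y" by (auto simp: in_segment)
      \<comment> \<open>Coordinate \<open>i\<close> forces \<open>u = 1\<close>, while coordinate
        \<open>j\<close> forces \<open>u = 0\<close>.\<close>
      have "y $ i = (1 - u) * x $ i + u * y $ i" "x $ j = (1 - u) * x $ j + u * y $ j"
        using arg_cong[OF u, of "\<lambda>v. v $ i"] arg_cong[OF u, of "\<lambda>v. v $ j"] j
        by (simp_all add: x'_def)
      then have "(1 - u) * (y $ i - x $ i) = 0" "u * (y $ j - x $ j) = 0"
        by algebra+
      then show False using i j by simp
    qed
    then show "card {i. x $ i \<noteq> y $ i} = 1" by simp
  next
    assume "card {i. x $ i \<noteq> y $ i} = 1"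
    then obtain i where i: "{i. x $ i \<noteq> y $ i} = {i}" by (auto simp: card_1_singleton_iff)
    then have ne: "x \<noteq> y" "x $ i \<noteq> y $ i" and eq: "\<And>j. j \<noteq> i \<Longrightarrow> x $ j = y $ j" by auto
    have mem: "a \<in> closed_segment x y" if aQ: "a \<in> cbox 0 1" and a: "\<And>j. j \<noteq> i \<Longrightarrow> a $ j = x $ j" for a
    proof -
      \<comment> \<open>The parameter of \<open>a\<close> on the segment: \<open>x $ i\<close> and
        \<open>y $ i\<close> are 0 and 1 in one order or the other.\<close>
      define t where "t = (if x $ i = 0 then a $ i else 1 - a $ i)"
      have "0 \<le> a $ i" "a $ i \<le> 1" using aQ by (auto simp: mem_box_cart)
      then have "0 \<le> t" "t \<le> 1" by (auto simp: t_def)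
      moreover have "x $ i \<in> {0, 1}" "y $ i \<in> {0, 1}" using x y by auto
      then have "a $ j = (1 - t) * x $ j + t * y $ j" for j
        using a[of j] eq[of j] ne(2) by (cases "j = i") (auto simp: t_def algebra_simps)
      then have "a = (1 - t) *\<^sub>R x + t *\<^sub>R y" by (simp add: vec_eq_iff)
      ultimately show ?thesis by (auto simp: in_segment)
    qed
    have "closed_segment x y face_of cbox 0 1"
      unfolding face_of_def
    proof (intro conjI ballI impI)
      show "closed_segment x y \<subseteq> cbox 0 1" using xyQ by (simp add: closed_segment_subset)
      show "convex (closed_segment x y)" by simp
    next
      fix a b z assume ab: "a \<in> cbox 0 1" "b \<in> cbox 0 1" and z: "z \<in> closed_segment x y" "z \<in> open_segment a b"
      have zj: "z $ j = x $ j" if "j \<noteq> i" for j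
      proof -
        obtain u where "z = (1 - u) *\<^sub>R x + u *\<^sub>R y" using z(1) by (auto simp: in_segment)
        then have "z $ j = (1 - u) * x $ j + u * y $ j" by simp
        then show ?thesis using eq[OF that] by (simp add: left_diff_distrib)
      qed
      have "a $ j = x $ j \<and> b $ j = x $ j" if "j \<noteq> i" for j
        using open_segment_component_at_bound[OF z(2) ab, of j] zj[OF that] x by metis
      then show "a \<in> closed_segment x y" "b \<in> closed_segment x y" using mem ab by blast+
    qed
    moreover have "aff_dim (closed_segment x y) = 1"
      using ne(1) by (simp add: segment_convex_hull aff_dim_convex_hull aff_dim_2)
    ultimately show "closed_segment x y edge_of cbox 0 1" by (simp add: edge_of_def)
  }
qed

lemma aff_dim_unit_cube: "aff_dim (cbox 0 1 :: (real ^ 'n) set) = int CARD('n)"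
proof -
  have "(\<chi> i. 1 / 2) \<in> box 0 (1 :: real ^ 'n)" by (simp add: mem_box_cart)
  then have "interior (cbox 0 (1 :: real ^ 'n)) \<noteq> {}" by (metis empty_iff interior_cbox)
  then show ?thesis by (simp add: aff_dim_nonempty_interior)
qed

section \<open>The cube graph as a polytope graph\<close>

lemma polytope_graph_edge_iff:
  "{x, y} \<in> edges (polytope_graph P) \<longleftrightarrow> closed_segment x y edge_of P"
  by (auto simp: polytope_graph_def doubleton_eq_iff closed_segment_commute)

text \<open>Casting coordinates to reals preserves Hamming distance, which decides adjacency on both
  sides.\<close>

lemma cube_graph_isomorphic_polytope_graph:
  "graph_isomorphic cube_graph (polytope_graph (cbox 0 1))"
proof -
  define h :: "nat ^ 3 \<Rightarrow> real ^ 3" where "h x = (\<chi> i. real (x $ i))" for x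
  have h [simp]: "h x $ i = real (x $ i)" for x i by (simp add: h_def)
  have "inj_on h (vertices cube_graph)" by (auto simp: inj_on_def vec_eq_iff)
  moreover have "h ` vertices cube_graph = vertices (polytope_graph (cbox 0 1))"
  proof
    show "h ` vertices cube_graph \<subseteq> vertices (polytope_graph (cbox 0 1))"
      by (auto simp: cube_graph_def polytope_graph_def extreme_point_of_unit_cube)
    show "vertices (polytope_graph (cbox 0 1)) \<subseteq> h ` vertices cube_graph"
    proof
      fix x assume "x \<in> vertices (polytope_graph (cbox 0 (1 :: real ^ 3)))"
      then have x: "x $ i \<in> {0, 1}" for i by (simp add: polytope_graph_def extreme_point_of_unit_cube)
      define y :: "nat ^ 3" where "y = (\<chi> i. if x $ i = 0 then 0 else 1)"
      have "h y $ i = x $ i" for i using x[of i] by (auto simp: y_def)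
      then have "x = h y" by (simp add: vec_eq_iff)
      moreover have "y \<in> vertices cube_graph" by (simp add: cube_graph_def y_def)
      ultimately show "x \<in> h ` vertices cube_graph" by blast
    qed
  qed
  ultimately have "bij_betw h (vertices cube_graph) (vertices (polytope_graph (cbox 0 1)))"
    by (simp add: bij_betw_def)
  moreover have "{x, y} \<in> edges cube_graph \<longleftrightarrow> {h x, h y} \<in> edges (polytope_graph (cbox 0 1))"
    if "x \<in> vertices cube_graph" "y \<in> vertices cube_graph" for x y
  proof -
    have "\<forall>i. h x $ i \<in> {0, 1}" "\<forall>i. h y $ i \<in> {0, 1}" using that by (auto simp: cube_graph_def)
    then have "closed_segment (h x) (h y) edge_of cbox 0 1 \<longleftrightarrow> card {i. h x $ i \<noteq> h y $ i} = 1"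
      by (rule edge_of_unit_cube_iff)
    then show ?thesis using cube_graph_edge_iff[OF that] by (simp add: polytope_graph_edge_iff)
  qed
  ultimately show ?thesis unfolding graph_isomorphic_def by blast
qed


section \<open>Realizations\<close>

lemma strong_polyhedral_realization_matching:
  assumes "strong_polyhedral_realization k I G A B f g" "k > 0"
  obtains \<phi> where "bij_betw \<phi> A B" "\<And>v w. v \<in> A \<Longrightarrow> w \<in> B \<Longrightarrow> {v, w} \<in> edges G \<longleftrightarrow> w \<noteq> \<phi> v"
proof -
  have "card A = k" "card B = k"
    "\<And>v. v \<in> A \<Longrightarrow> card {w \<in> B. {v, w} \<in> edges G} = k - 1"
    "\<And>w. w \<in> B \<Longrightarrow> card {v \<in> A. {v, w} \<in> edges G} = k - 1"
    using assms(1) unfolding strong_polyhedral_realization_def by blast+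
  then show thesis
    using regular_bipartite_complement_matching[OF \<open>k > 0\<close>] that by blast
qed

text \<open>The degree bound gives \<open>3 \<le> k - 1\<close>; five or more matched pairs would
  contain the subdivided K(3,3).\<close>

lemma strong_polyhedral_realization_size:
  fixes G :: "'v ugraph"
  assumes real: "strong_polyhedral_realization k I G A B f g" and k: "k > 0"
  shows "k = 4"
proof -
  obtain P :: "(real ^ 3) set" where P: "polytope P" "aff_dim P = 3"
    and iso: "graph_isomorphic G (polytope_graph P)"
    using real unfolding strong_polyhedral_realization_def polyhedral_graph_def by blast
  obtain h where h: "bij_betw h (vertices G) (vertices (polytope_graph P))"
    and adj: "\<And>x y. x \<in> vertices G \<Longrightarrow> y \<in> vertices G \<Longrightarrow>
      {x, y} \<in> edges G \<longleftrightarrow> closed_segment (h x) (h y) edge_of P"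
    using iso unfolding graph_isomorphic_def polytope_graph_edge_iff by blast
  have bip: "bipartition G A B" and cA: "card A = k" and cB: "card B = k"
    and deg: "\<And>v. v \<in> A \<Longrightarrow> card {w \<in> B. {v, w} \<in> edges G} = k - 1"
    using real unfolding strong_polyhedral_realization_def by auto
  have GV: "vertices G = A \<union> B" "A \<inter> B = {}" using bip by (auto simp: bipartition_def)
  obtain \<phi> where \<phi>: "bij_betw \<phi> A B"
    and adj\<phi>: "\<And>v w. v \<in> A \<Longrightarrow> w \<in> B \<Longrightarrow> {v, w} \<in> edges G \<longleftrightarrow> w \<noteq> \<phi> v"
    using strong_polyhedral_realization_matching[OF real k] by blast
  have fin: "finite A" "finite B" by (rule card_ge_0_finite; simp add: k cA cB)+
  have ext: "h v extreme_point_of P" if "v \<in> vertices G" for v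
    using bij_betwE[OF h] that by (auto simp: polytope_graph_def)
  have "k \<ge> 4"
  proof -
    obtain v where v: "v \<in> A" using cA k by fastforce
    define N where "N = {w. closed_segment (h v) w edge_of P}"
    \<comment> \<open>Polytope neighbours of \<open>h v\<close> pull back to graph neighbours of
      \<open>v\<close>, all of which lie in \<open>B\<close> by bipartiteness.\<close>
    have N: "N \<subseteq> h ` {w \<in> B. {v, w} \<in> edges G}"
    proof
      fix w assume "w \<in> N"
      then have w: "closed_segment (h v) w edge_of P" by (simp add: N_def)
      then have "w \<in> vertices (polytope_graph P)"
        using edge_segment_extreme by (auto simp: polytope_graph_def)
      then obtain u where u: "u \<in> vertices G" "w = h u" using h by (auto simp: bij_betw_def)
      then have "{v, u} \<in> edges G" using w adj v GV by auto
      moreover from this obtain a b where "a \<in> A" "b \<in> B" "{v, u} = {a, b}"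
        using bip by (auto simp: bipartition_def)
      then have "u \<in> B" using v GV(2) by (auto simp: doubleton_eq_iff)
      ultimately show "w \<in> h ` {w \<in> B. {v, w} \<in> edges G}" using u by blast
    qed
    have finN: "finite {w \<in> B. {v, w} \<in> edges G}" using fin by simp
    have "card N \<le> k - 1"
      using surj_card_le[OF finN N] deg[OF v] by simp
    moreover have "finite N" using N finN finite_surj by blast
    then have "aff_dim P \<le> int (card N)"
      unfolding N_def using v GV by (intro aff_dim_le_vertex_degree P ext) auto
    ultimately show ?thesis using P(2) by linarith
  qed
  moreover have "\<not> k \<ge> 5"
  proof
    assume "k \<ge> 5"
    then obtain T where T: "T \<subseteq> A" "card T = 5" using cA obtain_subset_with_card_n by metis
    then have "finite T" using fin finite_subset by blast
    then obtain xs where xs: "set xs = T" "distinct xs" using finite_distinct_list by blast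
    then have "length xs = 5" using T(2) distinct_card by metis
    then obtain a5 a1 a2 a3 a4 where xs_eq: "xs = [a5, a1, a2, a3, a4]"
      by (auto simp: numeral_eq_Suc length_Suc_conv)
    have a: "a1 \<in> A" "a2 \<in> A" "a3 \<in> A" "a4 \<in> A" "a5 \<in> A" and da: "distinct [a5, a1, a2, a3, a4]"
      using xs T(1) unfolding xs_eq by auto
    have ed: "closed_segment (h v) (h (\<phi> w)) edge_of P" if "v \<in> A" "w \<in> A" "v \<noteq> w" for v w
    proof -
      have "\<phi> w \<in> B" "\<phi> w \<noteq> \<phi> v"
        using \<phi> that by (auto simp: bij_betw_def inj_on_eq_iff)
      then show ?thesis using adj\<phi>[OF that(1)] adj that GV by auto
    qed
    have dh: "h v = h w \<longleftrightarrow> v = w" if "v \<in> A" "w \<in> A" for v w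
      using that h GV by (auto simp: bij_betw_def inj_on_eq_iff)
    have d\<phi>: "h (\<phi> v) = h (\<phi> w) \<longleftrightarrow> v = w" if "v \<in> A" "w \<in> A" for v w
    proof -
      have "\<phi> v = \<phi> w \<longleftrightarrow> v = w" "\<phi> v \<in> B" "\<phi> w \<in> B" using that \<phi> by (auto simp: bij_betw_def inj_on_eq_iff)
      then show ?thesis using h GV by (auto simp: bij_betw_def inj_on_eq_iff)
    qed
    have dc: "h v \<noteq> h (\<phi> w)" if "v \<in> A" "w \<in> A" for v w
    proof -
      have "\<phi> w \<in> B" using that \<phi> by (auto simp: bij_betw_def)
      then have "\<phi> w \<noteq> v" "\<phi> w \<in> vertices G" "v \<in> vertices G" using that GV by auto
      then show ?thesis using h by (auto simp: bij_betw_def inj_on_eq_iff)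
    qed
    show False
    \<comment> \<open>\<open>h a5\<close> is the point at infinity, and each \<open>b\<close> is the
      image of the \<open>\<phi>\<close>-partner of the \<open>a\<close> with the same index. None
      of the edges required joins equal indices, so all of them exist.\<close>
    proof (rule polytope_edges_no_K33_subdivision[OF P])
      show "h a5 extreme_point_of P" using ext a GV by blast
      show "distinct [h a5, h a1, h a2, h a3, h a4, h (\<phi> a1), h (\<phi> a3), h (\<phi> a4), h (\<phi> a5)]"
        using a da dh d\<phi> dc by auto
    qed (rule ed; use a da in auto)+
  qed
  ultimately show ?thesis by simp
qed

section \<open>The case of size four\<close>

lemma strong_polyhedral_realization_4_isomorphic_cube_graph:
  fixes G :: "'v ugraph"
  assumes real: "strong_polyhedral_realization 4 I G A B f g"
  shows "graph_isomorphic G cube_graph"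
proof -
  obtain \<phi> where \<phi>: "bij_betw \<phi> A B"
    and adj: "\<And>v w. v \<in> A \<Longrightarrow> w \<in> B \<Longrightarrow> {v, w} \<in> edges G \<longleftrightarrow> w \<noteq> \<phi> v"
    using strong_polyhedral_realization_matching[OF real] by auto
  have "bipartition G A B" "card A = 4"
    using real unfolding strong_polyhedral_realization_def by auto
  then show ?thesis using \<phi> adj by (rule crown_graph_4_isomorphic_cube_graph)
qed

text \<open>The complete bipartite graph on four plus four vertices minus a perfect matching is
  built on eight elements of \<open>'v\<close>; it is isomorphic to the cube graph, hence to the
  graph of the unit cube.\<close>

lemma strong_polyhedral_realization_4_exists:
  fixes I :: "'a pref_structure"
  assumes I: "complete_bipartite_pref_structure 4 I"
  shows "\<exists>(G :: 'v::infinite ugraph) VM VW f g. strong_polyhedral_realization 4 I G VM VW f g"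
proof -
  obtain e :: "nat \<Rightarrow> 'v" where e: "inj e"
    using infinite_UNIV infinite_countable_subset by blast
  define A where "A = e ` {0..<4}"
  define B where "B = e ` {4..<8}"
  define G where "G = \<lparr>vertices = A \<union> B,
    edges = {{e i, e (4 + j)} | i j. i < 4 \<and> j < 4 \<and> i \<noteq> j}\<rparr>"
  have e_iff: "e i = e j \<longleftrightarrow> i = j" for i j using e by (auto simp: inj_eq)
  have B: "B = (\<lambda>j. e (4 + j)) ` {0..<4}"
  proof -
    have "{4..<8} = (+) 4 ` {0..<(4::nat)}" by simp
    then show ?thesis unfolding B_def by (simp only: image_image)
  qed
  have cA: "card A = 4" and cB: "card B = 4"
    unfolding A_def B_def using e by (simp_all add: card_image inj_on_subset)
  have AB: "A \<inter> B = {}" unfolding A_def B_def using e_iff by auto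
  have bip: "bipartition G A B"
    unfolding bipartition_def using AB by (fastforce simp: G_def A_def B)
  \<comment> \<open>The removed matching: index \<open>i\<close> is paired with index
    \<open>4 + i\<close>.\<close>
  define \<phi> where "\<phi> v = e (4 + inv e v)" for v
  have \<phi>e: "\<phi> (e i) = e (4 + i)" for i using e by (simp add: \<phi>_def)
  have "inj_on \<phi> A" by (auto simp: inj_on_def A_def \<phi>e e_iff)
  moreover have "\<phi> ` A = B" unfolding A_def B image_image \<phi>e by simp
  ultimately have \<phi>: "bij_betw \<phi> A B" by (simp add: bij_betw_def)
  have edge: "{e i, e (4 + j)} \<in> edges G \<longleftrightarrow> i \<noteq> j" if "i < 4" "j < 4" for i j
    using that by (auto simp: G_def doubleton_eq_iff e_iff)
  have adj: "{v, w} \<in> edges G \<longleftrightarrow> w \<noteq> \<phi> v" if vw: "v \<in> A" "w \<in> B" for v w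
  proof -
    obtain i j where "i < 4" "j < 4" "v = e i" "w = e (4 + j)" using vw unfolding A_def B by auto
    then show ?thesis using edge by (auto simp: \<phi>e e_iff)
  qed
  have "graph_isomorphic G cube_graph"
    using crown_graph_4_isomorphic_cube_graph[OF bip cA \<phi> adj] .
  then have "graph_isomorphic G (polytope_graph (cbox 0 1))"
    using graph_isomorphic_trans cube_graph_isomorphic_polytope_graph by blast
  moreover have "polytope (cbox 0 (1 :: real ^ 3))" "aff_dim (cbox 0 (1 :: real ^ 3)) = 3"
    by (simp_all add: polytope_interval aff_dim_unit_cube)
  moreover have "simple_graph G"
    unfolding simple_graph_def by (auto simp: G_def A_def B e_iff card_insert_if)
  ultimately have poly: "polyhedral_graph G" unfolding polyhedral_graph_def by blast
  have degA: "card {w \<in> B. {v, w} \<in> edges G} = 3" if v: "v \<in> A" for v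
  proof -
    have "{w \<in> B. {v, w} \<in> edges G} = B - {\<phi> v}" using adj[OF v] by blast
    moreover have "\<phi> v \<in> B" using \<phi> v by (auto simp: bij_betw_def)
    ultimately show ?thesis using cB by simp
  qed
  have degB: "card {v \<in> A. {v, w} \<in> edges G} = 3" if w: "w \<in> B" for w
  proof -
    obtain u where u: "u \<in> A" "w = \<phi> u" using \<phi> w by (auto simp: bij_betw_def)
    have "{v \<in> A. {v, w} \<in> edges G} = A - {u}"
      using adj[OF _ w] \<phi> u by (auto simp: bij_betw_def inj_on_eq_iff)
    then show ?thesis using cA u by simp
  qed
  have "finite A" "finite B" by (simp_all add: A_def B_def)
  then obtain f g where "bij_betw f (men I) A" "bij_betw g (women I) B"
    using I cA cB finite_same_card_bij unfolding complete_bipartite_pref_structure_def by metis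
  then have "strong_polyhedral_realization 4 I G A B f g"
    using poly bip cA cB degA degB by (simp add: strong_polyhedral_realization_def)
  then show ?thesis by blast
qed

text \<open>Existence requires eight distinct vertices in \<open>'v\<close>, which the class
  \<open>infinite\<close> supplies; the isomorphism claim ranges over graphs on an arbitrary type
  \<open>'u\<close>.\<close>

theorem theorem4p2:
  fixes k :: nat and I :: "'a pref_structure"
  assumes "k > 0"
    and "complete_bipartite_pref_structure k I"
  shows "((\<exists>(G :: 'v::infinite ugraph) VM VW f g. strong_polyhedral_realization k I G VM VW f g)
            \<longleftrightarrow> k = 4) \<and>
         (k = 4 \<longrightarrow>
            (\<forall>(G :: 'u ugraph) VM VW f g. strong_polyhedral_realization k I G VM VW f g
               \<longrightarrow> graph_isomorphic G cube_graph))"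
proof (intro conjI iffI impI allI)
  assume "\<exists>(G :: 'v ugraph) VM VW f g. strong_polyhedral_realization k I G VM VW f g"
  then show "k = 4" using strong_polyhedral_realization_size \<open>k > 0\<close> by blast
next
  assume "k = 4"
  then show "\<exists>(G :: 'v ugraph) VM VW f g. strong_polyhedral_realization k I G VM VW f g"
    using strong_polyhedral_realization_4_exists assms(2) by blast
next
  fix G :: "'u ugraph" and VM VW f g
  assume "k = 4" "strong_polyhedral_realization k I G VM VW f g"
  then show "graph_isomorphic G cube_graph"
    using strong_polyhedral_realization_4_isomorphic_cube_graph by blast
qed

end
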